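(* Let $(S,d_S)$ be a separable metric space and let $\mathcal S$ denote its Borel $\sigma$-algebra. The following are equivalent: (1) Every Borel probability measure $\nu$ on $S$ is determined by its values on balls. (2) The collection $\Gamma_\varphi=\{f_{y,r}: y\in S,\ r>0\}$, where $f_{y,r}(x)=e^{-r\,d_S(x,y)}$, forms a separating class. (3) The collection $\Gamma_\phi=\{f_{y,\lambda}: y\in S,\ \lambda\in\mathbb R\}$, where $f_{y,\lambda}(x)=e^{\mathrm i\lambda d_S(x,y)}$ and $\mathrm i=\sqrt{-1}$, forms a separating class.
   Context: A collection $\Gamma$ of bounded measurable (real- or complex-valued) functions on $S$ forms a separating class if for any two Borel probability measures $\mu,\nu$ on $S$, $\int f\,d\mu=\int f\,d\nu$ for all $f\in\Gamma$ implies $\mu=\nu$. "Every Borel probability measure is determined by its values on balls" means: if two Borel probability measures on $S$ agree on every open ball $B_r(x)=\{y\in S:d_S(x,y)<r\}$, $x\in S$, $r>0$, then they are equal. *)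

theory Defs
  imports "HOL-Probability.Probability"
begin

definition borel_prob :: "'a::topological_space measure \<Rightarrow> bool" where
  "borel_prob \<mu> \<longleftrightarrow> prob_space \<mu> \<and> sets \<mu> = sets borel"

definition determined_by_balls :: "'a::metric_space itself \<Rightarrow> bool" where
  "determined_by_balls (_ :: 'a itself) \<longleftrightarrow>
     (\<forall>\<mu> \<nu> :: 'a measure. borel_prob \<mu> \<and> borel_prob \<nu> \<and>
        (\<forall>x r. r > 0 \<longrightarrow> measure \<mu> (ball x r) = measure \<nu> (ball x r)) \<longrightarrow> \<mu> = \<nu>)"

(* Polymorphic in the codomain so that the same notion covers real-valued and
   complex-valued classes; it is only used at 'b = real and 'b = complex. *)
definition separating_class ::
  "('a::topological_space \<Rightarrow> 'b::{banach, second_countable_topology}) set \<Rightarrow> bool" where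
  "separating_class \<Gamma> \<longleftrightarrow>
     (\<forall>f\<in>\<Gamma>. f \<in> borel_measurable borel \<and> bounded (range f)) \<and>
     (\<forall>\<mu> \<nu> :: 'a measure. borel_prob \<mu> \<and> borel_prob \<nu> \<and>
        (\<forall>f\<in>\<Gamma>. (\<integral>x. f x \<partial>\<mu>) = (\<integral>x. f x \<partial>\<nu>)) \<longrightarrow> \<mu> = \<nu>)"

definition Gamma_exp :: "('a::metric_space \<Rightarrow> real) set" where
  "Gamma_exp = {\<lambda>x. exp (- r * dist x y) | y r. r > 0}"

definition Gamma_char :: "('a::metric_space \<Rightarrow> complex) set" where
  "Gamma_char = {\<lambda>x. exp (\<i> * complex_of_real (l * dist x y)) | y l. True}"

end

theory Submission
  imports Defs
begin

text \<open>
  For a point \<open>y\<close> and a Borel probability measure \<open>\<mu>\<close>, all three families see \<open>\<mu>\<close> only through the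
  law on the real line of the distance to \<open>y\<close>, that is, the image of \<open>\<mu>\<close> under \<open>\<lambda>x. dist x y\<close>.
  The measures of the balls about \<open>y\<close> are the values of this law on the rays \<open>{..<r}\<close>, the integrals
  of the functions \<open>\<lambda>x. exp (- r * dist x y)\<close> are its Laplace transform, and those of the functions
  \<open>\<lambda>x. exp (\<i> * (l * dist x y))\<close> are its characteristic function. Each of the three determines a
  law on the half-line \<open>{0..}\<close>, so each family agrees on two measures exactly if, for every \<open>y\<close>, the
  two laws of the distance to \<open>y\<close> coincide. The three statements thus say the same: these
  laws, over all \<open>y\<close>, determine the measure.

  For the rays this is a \<open>\<pi>\<close>-system argument, and for the characteristic function it is Levy's
  uniqueness theorem. Uniqueness for the Laplace transform reduces to Levy's theorem by the
  substitution \<open>u = exp (- d)\<close>: the values of the transform at the positive integers are the moments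
  of a law on \<open>{0..1}\<close>, and the moments of a bounded law are, up to the factors \<open>\<i> ^ k / fact k\<close>,
  the coefficients of the everywhere convergent power series of its characteristic function.
\<close>

section \<open>Uniqueness theorems for laws on the real line\<close>

text \<open>
  Reflection at the origin turns the rays \<open>{..<r}\<close> into the rays \<open>{x<..}\<close>, which are known to
  determine a law.
\<close>

lemma real_distribution_eqI_lessThan:
  assumes M: "real_distribution M" and N: "real_distribution N"
    and eq: "\<And>r. measure M {..<r} = measure N {..<r}"
  shows "M = N"
proof -
  interpret M: real_distribution M by (rule M)
  interpret N: real_distribution N by (rule N)
  have vimage: "uminus -` {x<..} = {..<- x}" for x :: real by auto
  have refl_eq: "distr M borel uminus = distr N borel uminus"
  proof (rule measure_eqI_lessThan)
    fix x :: real
    show "emeasure (distr M borel uminus) {x<..} = emeasure (distr N borel uminus) {x<..}"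
      by (simp add: emeasure_distr vimage M.emeasure_eq_measure N.emeasure_eq_measure eq)
    show "emeasure (distr M borel uminus) {x<..} < \<infinity>"
      by (simp add: emeasure_distr vimage M.emeasure_eq_measure)
  qed simp_all
  have reflect_twice: "distr (distr K borel uminus) borel uminus = K"
    if "sets K = sets borel" for K :: "real measure"
  proof -
    have "uminus \<in> borel_measurable K" by (simp cong: measurable_cong_sets add: that)
    then have "distr (distr K borel uminus) borel uminus = distr K borel (\<lambda>x. x)"
      by (simp add: distr_distr comp_def)
    also have "\<dots> = K" using that by (intro distr_id2) simp
    finally show ?thesis .
  qed
  show ?thesis
    using reflect_twice[OF M.events_eq_borel] reflect_twice[OF N.events_eq_borel]
    unfolding refl_eq by (rule trans[OF sym])
qed

text \<open>
  For a law bounded by \<open>B\<close>, the exponential series of \<open>exp (\<i> * t * x)\<close> is dominated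
  by that of \<open>exp (\<bar>t\<bar> * B)\<close> and may be integrated term by term.
\<close>

lemma char_sums_moments:
  assumes "real_distribution M" and bounded: "AE x in M. \<bar>x\<bar> \<le> B"
  shows "(\<lambda>k. ((\<i> * of_real t) ^ k /\<^sub>R fact k) * of_real (\<integral>x. x ^ k \<partial>M)) sums char M t"
proof -
  interpret real_distribution M by (rule assms(1))
  define f :: "nat \<Rightarrow> real \<Rightarrow> complex" where
    "f = (\<lambda>k x. (\<i> * of_real (t * x)) ^ k /\<^sub>R fact k)"
  have f_split: "f k x = ((\<i> * of_real t) ^ k /\<^sub>R fact k) * of_real (x ^ k)" for k x
    by (simp add: f_def power_mult_distrib)
  have f_measurable [measurable]: "f k \<in> borel_measurable M" for k
    unfolding f_def by measurable
  have norm_f: "norm (f k x) = \<bar>t * x\<bar> ^ k /\<^sub>R fact k" for k x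
    by (simp add: f_def norm_power norm_mult abs_mult power_mult_distrib)
  have bound: "AE x in M. norm (f k x) \<le> (\<bar>t\<bar> * B) ^ k /\<^sub>R fact k" for k
    using bounded
  proof eventually_elim
    case (elim x)
    then have "\<bar>t * x\<bar> ^ k \<le> (\<bar>t\<bar> * B) ^ k"
      by (intro power_mono) (auto simp: abs_mult intro: mult_left_mono)
    then show ?case by (simp add: norm_f divide_simps)
  qed
  have f_integrable: "integrable M (f k)" for k
    by (rule integrable_const_bound[OF bound]) simp
  have "(\<lambda>k. integral\<^sup>L M (f k)) sums (\<integral>x. (\<Sum>k. f k x) \<partial>M)"
  proof (rule sums_integral)
    show "integrable M (f k)" for k by (rule f_integrable)
    show "AE x in M. summable (\<lambda>k. norm (f k x))"
      unfolding norm_f by (intro AE_I2 summable_exp_generic)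
    show "summable (\<lambda>k. \<integral>x. norm (f k x) \<partial>M)"
    proof (rule summable_comparison_test[OF _ summable_exp_generic[of "\<bar>t\<bar> * B"]], intro exI allI impI)
      fix k :: nat
      have "(\<integral>x. norm (f k x) \<partial>M) \<le> (\<bar>t\<bar> * B) ^ k /\<^sub>R fact k"
        using bound[of k] f_integrable[of k] by (intro integral_le_const) auto
      then show "norm (\<integral>x. norm (f k x) \<partial>M) \<le> (\<bar>t\<bar> * B) ^ k /\<^sub>R fact k"
        by simp
    qed
  qed
  moreover have "(\<Sum>k. f k x) = iexp (t * x)" for x
    unfolding f_def by (rule sums_unique[symmetric, OF exp_converges])
  moreover have "integral\<^sup>L M (f k) = ((\<i> * of_real t) ^ k /\<^sub>R fact k) * of_real (\<integral>x. x ^ k \<partial>M)" for k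
    unfolding f_split integral_mult_right_zero integral_complex_of_real ..
  ultimately show ?thesis by (simp add: char_def)
qed

lemma real_distribution_eqI_moments:
  assumes M: "real_distribution M" and N: "real_distribution N"
    and "AE x in M. \<bar>x\<bar> \<le> B" and "AE x in N. \<bar>x\<bar> \<le> B"
    and moments: "\<And>k. (\<integral>x. x ^ k \<partial>M) = (\<integral>x. x ^ k \<partial>N)"
  shows "M = N"
proof (rule Levy_uniqueness[OF M N], rule ext)
  fix t
  show "char M t = char N t"
    using char_sums_moments[OF M assms(3), of t] char_sums_moments[OF N assms(4), of t]
    by (simp add: moments sums_unique2)
qed

text \<open>
  The law of \<open>exp (- d)\<close> is bounded, and its moments are values of the Laplace transform of the
  law of \<open>d\<close>.
\<close>

lemma real_distribution_eqI_Laplace: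
  assumes M: "real_distribution M" and N: "real_distribution N"
    and M_nonneg: "AE x in M. 0 \<le> x" and N_nonneg: "AE x in N. 0 \<le> x"
    and eq: "\<And>r. 0 < r \<Longrightarrow> (\<integral>x. exp (- r * x) \<partial>M) = (\<integral>x. exp (- r * x) \<partial>N)"
  shows "M = N"
proof -
  interpret M: real_distribution M by (rule M)
  interpret N: real_distribution N by (rule N)
  define u :: "real \<Rightarrow> real" where "u = (\<lambda>x. exp (- x))"
  have u_borel [measurable]: "u \<in> borel_measurable borel" unfolding u_def by measurable
  have u_power: "u x ^ k = exp (- real k * x)" for x k
    by (simp add: u_def exp_of_nat_mult[symmetric])
  have "distr M borel u = distr N borel u"
  proof (rule real_distribution_eqI_moments[where B = 1])
    show "real_distribution (distr M borel u)" "real_distribution (distr N borel u)"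
      by simp_all
    show "AE x in distr M borel u. \<bar>x\<bar> \<le> 1" "AE x in distr N borel u. \<bar>x\<bar> \<le> 1"
      using M_nonneg N_nonneg by (simp_all add: AE_distr_iff u_def)
    fix k :: nat
    (* The transform is given only at positive arguments; the moment of order 0 is the total mass. *)
    have "(\<integral>x. exp (- real k * x) \<partial>M) = (\<integral>x. exp (- real k * x) \<partial>N)"
      using eq[of "real k"] M.prob_space N.prob_space by (cases "k = 0") simp_all
    then show "(\<integral>x. x ^ k \<partial>distr M borel u) = (\<integral>x. x ^ k \<partial>distr N borel u)"
      by (simp add: integral_distr u_power)
  qed
  then have "distr (distr M borel u) borel (\<lambda>x. - ln x) = distr (distr N borel u) borel (\<lambda>x. - ln x)"
    by simp
  moreover have "distr (distr K borel u) borel (\<lambda>x. - ln x) = K"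
    if "real_distribution K" for K
  proof -
    interpret K: real_distribution K by (rule that)
    have "distr (distr K borel u) borel (\<lambda>x. - ln x) = distr K borel (\<lambda>x. x)"
      by (subst distr_distr) (simp_all add: comp_def u_def)
    also have "\<dots> = K" by (intro distr_id2) simp
    finally show ?thesis .
  qed
  ultimately show ?thesis using M N by metis
qed

section \<open>The law of the distance to a point\<close>

definition dist_law :: "'a::metric_space measure \<Rightarrow> 'a \<Rightarrow> real measure" where
  "dist_law \<mu> y = distr \<mu> borel (\<lambda>x. dist x y)"

lemma dist_to_measurable:
  assumes "borel_prob \<mu>"
  shows "(\<lambda>x. dist x y) \<in> borel_measurable \<mu>"
proof -
  have "(\<lambda>x. dist x y) \<in> borel_measurable borel"
    by (intro borel_measurable_continuous_onI continuous_intros)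
  then show ?thesis
    using assms by (simp add: borel_prob_def cong: measurable_cong_sets)
qed

lemma real_distribution_dist_law:
  assumes "borel_prob \<mu>"
  shows "real_distribution (dist_law \<mu> y)"
proof -
  interpret prob_space \<mu> using assms by (simp add: borel_prob_def)
  show ?thesis
    unfolding dist_law_def by (intro real_distribution_distr dist_to_measurable assms)
qed

lemma AE_dist_law_nonneg:
  assumes "borel_prob \<mu>"
  shows "AE x in dist_law \<mu> y. 0 \<le> x"
  unfolding dist_law_def by (simp add: AE_distr_iff dist_to_measurable[OF assms])

lemma integral_dist_law:
  fixes g :: "real \<Rightarrow> 'b::{banach, second_countable_topology}"
  assumes "borel_prob \<mu>" and "g \<in> borel_measurable borel"
  shows "(\<integral>t. g t \<partial>dist_law \<mu> y) = (\<integral>x. g (dist x y) \<partial>\<mu>)"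
  unfolding dist_law_def by (intro integral_distr dist_to_measurable assms)

lemma measure_dist_law_lessThan:
  assumes "borel_prob \<mu>"
  shows "measure (dist_law \<mu> y) {..<r} = measure \<mu> (ball y r)"
proof -
  have "space \<mu> = UNIV"
    using assms sets_eq_imp_space_eq[of \<mu> borel] by (simp add: borel_prob_def)
  moreover have "(\<lambda>x. dist x y) -` {..<r} = ball y r"
    by (auto simp: dist_commute)
  ultimately show ?thesis
    unfolding dist_law_def by (simp add: measure_distr dist_to_measurable[OF assms])
qed

section \<open>Each family of data is equivalent to the distance laws\<close>

lemma ball_measures_eq_iff_dist_law_eq:
  assumes \<mu>: "borel_prob \<mu>" and \<nu>: "borel_prob \<nu>"
  shows "(\<forall>r>0. measure \<mu> (ball y r) = measure \<nu> (ball y r)) \<longleftrightarrow> dist_law \<mu> y = dist_law \<nu> y"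
proof
  assume balls: "\<forall>r>0. measure \<mu> (ball y r) = measure \<nu> (ball y r)"
  show "dist_law \<mu> y = dist_law \<nu> y"
  proof (rule real_distribution_eqI_lessThan)
    fix r :: real
    show "measure (dist_law \<mu> y) {..<r} = measure (dist_law \<nu> y) {..<r}"
      unfolding measure_dist_law_lessThan[OF \<mu>] measure_dist_law_lessThan[OF \<nu>]
      using balls by (cases "r > 0") (simp_all add: ball_empty)
  qed (intro real_distribution_dist_law \<mu> \<nu>)+
next
  assume "dist_law \<mu> y = dist_law \<nu> y"
  then show "\<forall>r>0. measure \<mu> (ball y r) = measure \<nu> (ball y r)"
    using measure_dist_law_lessThan[OF \<mu>] measure_dist_law_lessThan[OF \<nu>] by metis
qed

lemma exp_integrals_eq_iff_dist_law_eq: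
  assumes \<mu>: "borel_prob \<mu>" and \<nu>: "borel_prob \<nu>"
  shows "(\<forall>r>0. (\<integral>x. exp (- r * dist x y) \<partial>\<mu>) = (\<integral>x. exp (- r * dist x y) \<partial>\<nu>))
    \<longleftrightarrow> dist_law \<mu> y = dist_law \<nu> y"
proof -
  have law: "(\<integral>x. exp (- r * dist x y) \<partial>\<kappa>) = (\<integral>t. exp (- r * t) \<partial>dist_law \<kappa> y)"
    if "borel_prob \<kappa>" for \<kappa> and r :: real
    by (rule integral_dist_law[symmetric, OF that]) measurable
  show ?thesis
    unfolding law[OF \<mu>] law[OF \<nu>]
  proof
    assume "\<forall>r>0. (\<integral>t. exp (- r * t) \<partial>dist_law \<mu> y) = (\<integral>t. exp (- r * t) \<partial>dist_law \<nu> y)"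
    then show "dist_law \<mu> y = dist_law \<nu> y"
      by (intro real_distribution_eqI_Laplace real_distribution_dist_law AE_dist_law_nonneg \<mu> \<nu>) blast
  qed simp
qed

lemma char_integrals_eq_iff_dist_law_eq:
  assumes \<mu>: "borel_prob \<mu>" and \<nu>: "borel_prob \<nu>"
  shows "(\<forall>l. (\<integral>x. iexp (l * dist x y) \<partial>\<mu>) = (\<integral>x. iexp (l * dist x y) \<partial>\<nu>))
    \<longleftrightarrow> dist_law \<mu> y = dist_law \<nu> y"
proof -
  have law: "(\<integral>x. iexp (l * dist x y) \<partial>\<kappa>) = char (dist_law \<kappa> y) l"
    if "borel_prob \<kappa>" for \<kappa> l
    unfolding char_def by (rule integral_dist_law[symmetric, OF that]) measurable
  show ?thesis
    unfolding law[OF \<mu>] law[OF \<nu>]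
  proof
    assume "\<forall>l. char (dist_law \<mu> y) l = char (dist_law \<nu> y) l"
    then show "dist_law \<mu> y = dist_law \<nu> y"
      by (intro Levy_uniqueness real_distribution_dist_law \<mu> \<nu> ext) blast
  qed simp
qed

section \<open>Determination by the distance laws\<close>

definition determined_by_dist_laws :: "'a::metric_space itself \<Rightarrow> bool" where
  "determined_by_dist_laws (_ :: 'a itself) \<longleftrightarrow>
     (\<forall>\<mu> \<nu> :: 'a measure. borel_prob \<mu> \<and> borel_prob \<nu> \<and>
        (\<forall>y. dist_law \<mu> y = dist_law \<nu> y) \<longrightarrow> \<mu> = \<nu>)"

lemma determined_by_balls_iff:
  "determined_by_balls TYPE('a::metric_space) \<longleftrightarrow> determined_by_dist_laws TYPE('a)"
proof -
  have "(\<forall>y r. r > 0 \<longrightarrow> measure \<mu> (ball y r) = measure \<nu> (ball y r))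
      \<longleftrightarrow> (\<forall>y. dist_law \<mu> y = dist_law \<nu> y)"
    if "borel_prob \<mu>" and "borel_prob \<nu>" for \<mu> \<nu> :: "'a measure"
    unfolding ball_measures_eq_iff_dist_law_eq[OF that, symmetric] by blast
  then show ?thesis
    unfolding determined_by_balls_def determined_by_dist_laws_def by blast
qed

lemma separating_Gamma_exp_iff:
  "separating_class (Gamma_exp :: ('a::metric_space \<Rightarrow> real) set)
    \<longleftrightarrow> determined_by_dist_laws TYPE('a)"
proof -
  have admissible: "f \<in> borel_measurable borel \<and> bounded (range f)"
    if "f \<in> Gamma_exp" for f :: "'a \<Rightarrow> real"
  proof -
    obtain y r where f: "f = (\<lambda>x. exp (- r * dist x y))" and "r > 0"
      using \<open>f \<in> Gamma_exp\<close> by (auto simp: Gamma_exp_def)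
    have "f \<in> borel_measurable borel"
      unfolding f by (intro borel_measurable_continuous_onI continuous_intros)
    moreover have "bounded (range f)"
      unfolding bounded_iff f using \<open>r > 0\<close> by (intro exI[of _ 1]) auto
    ultimately show ?thesis ..
  qed
  have "(\<forall>f\<in>Gamma_exp. (\<integral>x. f x \<partial>\<mu>) = (\<integral>x. f x \<partial>\<nu>)) \<longleftrightarrow> (\<forall>y. dist_law \<mu> y = dist_law \<nu> y)"
    if \<mu>: "borel_prob \<mu>" and \<nu>: "borel_prob \<nu>" for \<mu> \<nu> :: "'a measure"
  proof -
    have "(\<forall>f\<in>Gamma_exp. (\<integral>x. f x \<partial>\<mu>) = (\<integral>x. f x \<partial>\<nu>)) \<longleftrightarrow>
        (\<forall>y. \<forall>r>0. (\<integral>x. exp (- r * dist x y) \<partial>\<mu>) = (\<integral>x. exp (- r * dist x y) \<partial>\<nu>))"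
      unfolding Gamma_exp_def by blast
    then show ?thesis
      unfolding exp_integrals_eq_iff_dist_law_eq[OF \<mu> \<nu>] .
  qed
  then show ?thesis
    unfolding separating_class_def determined_by_dist_laws_def using admissible by blast
qed

lemma separating_Gamma_char_iff:
  "separating_class (Gamma_char :: ('a::metric_space \<Rightarrow> complex) set)
    \<longleftrightarrow> determined_by_dist_laws TYPE('a)"
proof -
  have admissible: "f \<in> borel_measurable borel \<and> bounded (range f)"
    if "f \<in> Gamma_char" for f :: "'a \<Rightarrow> complex"
  proof -
    obtain y l where f: "f = (\<lambda>x. iexp (l * dist x y))"
      using \<open>f \<in> Gamma_char\<close> by (auto simp: Gamma_char_def)
    have "f \<in> borel_measurable borel"
      unfolding f by (intro borel_measurable_continuous_onI continuous_intros)
    moreover have "bounded (range f)"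
      unfolding bounded_iff f by (intro exI[of _ 1]) (auto simp del: of_real_mult)
    ultimately show ?thesis ..
  qed
  have "(\<forall>f\<in>Gamma_char. (\<integral>x. f x \<partial>\<mu>) = (\<integral>x. f x \<partial>\<nu>)) \<longleftrightarrow> (\<forall>y. dist_law \<mu> y = dist_law \<nu> y)"
    if \<mu>: "borel_prob \<mu>" and \<nu>: "borel_prob \<nu>" for \<mu> \<nu> :: "'a measure"
  proof -
    have "(\<forall>f\<in>Gamma_char. (\<integral>x. f x \<partial>\<mu>) = (\<integral>x. f x \<partial>\<nu>)) \<longleftrightarrow>
        (\<forall>y. \<forall>l. (\<integral>x. iexp (l * dist x y) \<partial>\<mu>) = (\<integral>x. iexp (l * dist x y) \<partial>\<nu>))"
      unfolding Gamma_char_def by blast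
    then show ?thesis
      unfolding char_integrals_eq_iff_dist_law_eq[OF \<mu> \<nu>] .
  qed
  then show ?thesis
    unfolding separating_class_def determined_by_dist_laws_def using admissible by blast
qed

theorem lemma2p3:
  assumes "separable_space (euclidean :: 'a::metric_space topology)"
  shows "(determined_by_balls TYPE('a) \<longleftrightarrow> separating_class (Gamma_exp :: ('a \<Rightarrow> real) set)) \<and>
         (separating_class (Gamma_exp :: ('a \<Rightarrow> real) set) \<longleftrightarrow>
            separating_class (Gamma_char :: ('a \<Rightarrow> complex) set))"
  by (simp add: determined_by_balls_iff separating_Gamma_exp_iff separating_Gamma_char_iff)

end
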